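(* Let $n\ge1$, $1<p<\infty$ and $0<\gamma\le n$. For $f\in L^1_{\rm loc}(\mathbb{R}^n)$ and $Q\in\mathcal{D}$ set $b(f)_Q=\ell(Q)^{\gamma/p}O(f,Q)$. Then there is no constant $C$ such that $$\|b(f)\|_{l^{p,\infty}_\gamma(\mathbb{R}^n)}\le C\|f\|_{\mathrm{JN}_p(\mathbb{R}^n,\mathcal{D})}\quad\text{for all }f\in L^1_{\rm loc}(\mathbb{R}^n),$$ and there is no constant $C$ such that $$\|b(f)\|_{l^{p,\infty}_\gamma(\mathbb{R}^n)}\le C\|f\|_{L^{p,\infty}(\mathbb{R}^n)}\quad\text{for all }f\in L^1_{\rm loc}(\mathbb{R}^n).$$
   Context: The measure is Lebesgue measure. $\mathcal{D}$ is the collection of half-open dyadic cubes $[j_12^k,(j_1+1)2^k)\times\cdots\times[j_n2^k,(j_n+1)2^k)$, $k\in\mathbb{Z}$, $j\in\mathbb{Z}^n$; $\ell(Q)$ is the sidelength; $O(f,Q)=\frac1{|Q|}\int_Q|f-f_Q|$ with $f_Q=\frac1{|Q|}\int_Qf$. For a sequence $a=\{a_Q\}_{Q\in\mathcal{D}}$, $$\|a\|_{l^{p,\infty}_\gamma(\mathbb{R}^n)}=\Big(\sup_{\lambda>0}\lambda^p\sum_{Q\in\mathcal{D},\,|a_Q|>\lambda}\ell(Q)^{-\gamma}|Q|\Big)^{1/p}.$$ $$\|f\|_{\mathrm{JN}_p(\mathbb{R}^n,\mathcal{D})}=\Big(\sup_{\mathcal{P}}\sum_{Q\in\mathcal{P}}|Q|\,O(f,Q)^p\Big)^{1/p},$$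 the supremum over all collections $\mathcal{P}\subset\mathcal{D}$ of pairwise disjoint cubes. $\|f\|_{L^{p,\infty}(\mathbb{R}^n)}=(\sup_{\lambda>0}\lambda^p|\{|f|>\lambda\}|)^{1/p}$. *)

theory Defs
  imports "HOL-Analysis.Analysis"
begin

definition ennreal_powr :: "ennreal \<Rightarrow> real \<Rightarrow> ennreal" where
  \<comment> \<open>real power on \<open>[0, \<infinity>]\<close>, intended for exponents \<open>a > 0\<close> only\<close>
  "ennreal_powr x a = (if x = top then top else ennreal (enn2real x powr a))"

definition dyadic_cube :: "int \<Rightarrow> int ^ 'n \<Rightarrow> (real ^ 'n) set" where
  "dyadic_cube k j = {x. \<forall>i. of_int (j $ i) * 2 powi k \<le> x $ i \<and>
                              x $ i < (of_int (j $ i) + 1) * 2 powi k}"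

definition dyadic_cubes :: "(real ^ 'n) set set" where
  "dyadic_cubes = {Q. \<exists>k j. Q = dyadic_cube k j}"

definition side_length :: "(real ^ 'n) set \<Rightarrow> real" where
  \<comment> \<open>well defined on dyadic cubes by \<open>side_length_dyadic_cube\<close> below\<close>
  "side_length Q = (THE l. \<exists>k j. Q = dyadic_cube k j \<and> l = 2 powi k)"

lemma dyadic_cube_coordinate_image:
  fixes j :: "int ^ 'n::finite"
  shows "(\<lambda>x. x $ i) ` dyadic_cube k j
       = {of_int (j $ i) * 2 powi k ..< (of_int (j $ i) + 1) * 2 powi k}"
proof (intro equalityI subsetI)
  fix t :: real
  assume t: "t \<in> {of_int (j $ i) * 2 powi k ..< (of_int (j $ i) + 1) * 2 powi k}"
  define x :: "real ^ 'n" where "x = (\<chi> m. if m = i then t else of_int (j $ m) * 2 powi k)"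
  have "x \<in> dyadic_cube k j"
    using t by (auto simp: dyadic_cube_def x_def algebra_simps)
  moreover have "x $ i = t" by (simp add: x_def)
  ultimately show "t \<in> (\<lambda>x. x $ i) ` dyadic_cube k j" by blast
qed (auto simp: dyadic_cube_def)

lemma side_length_dyadic_cube:
  fixes j :: "int ^ 'n::finite"
  shows "side_length (dyadic_cube k j) = 2 powi k"
  unfolding side_length_def
proof (rule the_equality)
  fix l :: real
  assume "\<exists>k' j'. dyadic_cube k j = dyadic_cube k' j' \<and> l = 2 powi k'"
  then obtain k' j' where eq: "dyadic_cube k j = dyadic_cube k' j'" and l: "l = 2 powi k'"
    by blast
  define i :: 'n where "i = undefined"
  have "{real_of_int (j $ i) * 2 powi k ..< (of_int (j $ i) + 1) * 2 powi k}
      = {of_int (j' $ i) * 2 powi k' ..< (of_int (j' $ i) + 1) * 2 powi k'}"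
    using dyadic_cube_coordinate_image[of i k j] dyadic_cube_coordinate_image[of i k' j'] eq
    by simp
  then have "real_of_int (j $ i) * 2 powi k = of_int (j' $ i) * 2 powi k'
      \<and> (real_of_int (j $ i) + 1) * 2 powi k = (of_int (j' $ i) + 1) * 2 powi k'"
    by (subst (asm) Ico_eq_Ico) (auto simp: algebra_simps)
  then show "l = 2 powi k"
    using l by (simp add: algebra_simps)
qed blast

definition locally_integrable :: "('a::euclidean_space \<Rightarrow> real) \<Rightarrow> bool" where
  "locally_integrable f \<longleftrightarrow> (\<forall>K. compact K \<longrightarrow> set_integrable lebesgue K f)"

definition mean_value :: "(real ^ 'n::finite \<Rightarrow> real) \<Rightarrow> (real ^ 'n) set \<Rightarrow> real" where
  "mean_value f Q = (1 / measure lebesgue Q) * (LINT x:Q|lebesgue. f x)"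

definition mean_osc :: "(real ^ 'n::finite \<Rightarrow> real) \<Rightarrow> (real ^ 'n) set \<Rightarrow> real" where
  "mean_osc f Q = (1 / measure lebesgue Q) * (LINT x:Q|lebesgue. \<bar>f x - mean_value f Q\<bar>)"

definition weak_seq_norm ::
  "real \<Rightarrow> real \<Rightarrow> ((real ^ 'n::finite) set \<Rightarrow> real) \<Rightarrow> ennreal" where
  "weak_seq_norm p \<gamma> a = ennreal_powr
     (SUP l\<in>{0<..}. ennreal (l powr p) *
        (\<Sum>\<^sub>\<infinity>Q\<in>{Q \<in> dyadic_cubes. \<bar>a Q\<bar> > l}.
           ennreal (side_length Q powr (-\<gamma>)) * emeasure lebesgue Q)) (1 / p)"

definition JN_norm :: "real \<Rightarrow> (real ^ 'n::finite \<Rightarrow> real) \<Rightarrow> ennreal" where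
  "JN_norm p f = ennreal_powr
     (SUP P\<in>{P. P \<subseteq> dyadic_cubes \<and> disjoint P}.
        (\<Sum>\<^sub>\<infinity>Q\<in>P. emeasure lebesgue Q * ennreal (mean_osc f Q powr p))) (1 / p)"

definition weak_Lp_norm :: "real \<Rightarrow> (real ^ 'n::finite \<Rightarrow> real) \<Rightarrow> ennreal" where
  "weak_Lp_norm p f = ennreal_powr
     (SUP l\<in>{0<..}. ennreal (l powr p) * emeasure lebesgue {x. \<bar>f x\<bar> > l}) (1 / p)"

definition osc_seq ::
  "real \<Rightarrow> real \<Rightarrow> (real ^ 'n::finite \<Rightarrow> real) \<Rightarrow> (real ^ 'n) set \<Rightarrow> real" where
  "osc_seq p \<gamma> f Q = side_length Q powr (\<gamma> / p) * mean_osc f Q"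

end

theory Submission
  imports Defs
begin

text \<open>Both inequalities fail for the same functions. Let \<open>F\<^sub>m\<close> be the \<open>m\<close>-th stage of a Cantor-type
  set of dimension \<open>n - \<gamma>\<close>: a decreasing sequence of unions of dyadic cubes with
  \<open>|F\<^sub>m| = 2\<^sup>-\<^sup>n\<^sup>m\<close>, built of cubes of side about \<open>2 powr (- n m / \<gamma>)\<close>. Put
  \<open>f = \<Sum>\<^sub>i\<^sub>\<le>\<^sub>K 2 powr (n i / p) 1\<^bsub>F\<^sub>i\<^esub>\<close>, roughly the distance to the Cantor set to the power
  \<open>- \<gamma> / p\<close>. Its weak \<open>L\<^sup>p\<close> norm is bounded uniformly in \<open>K\<close>.
  So is its John-Nirenberg norm: \<open>|Q| O(f, Q)\<^sup>p\<close> is at most a constant times the mass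
  of \<open>Q\<close> under the natural probability measure on the Cantor set. At each of the \<open>K\<close> scales,
  however, all the cubes forming \<open>F\<^sub>m\<close> satisfy \<open>\<ell>(Q) powr (\<gamma> / p) O(f, Q) > \<lambda>\<close> for one fixed
  \<open>\<lambda>\<close>, and each scale contributes a fixed amount to \<open>\<Sum> \<ell>(Q) powr (- \<gamma>) |Q|\<close>, which therefore
  grows linearly in \<open>K\<close>.\<close>

subsection \<open>Dyadic grids\<close>

text \<open>Dyadic cubes of side \<open>2 powi k\<close> are the fibres of this map, so disjointness
  within a generation is immediate and nesting between generations becomes integer division.\<close>

definition grid_index :: "int \<Rightarrow> real ^ 'n \<Rightarrow> int ^ 'n" where
  "grid_index k x = (\<chi> c. \<lfloor>x $ c / 2 powi k\<rfloor>)"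

\<comment> \<open>\<open>A\<close> is a union of dyadic cubes of side \<open>2 powi k\<close>.\<close>
definition grid_set :: "int \<Rightarrow> (real ^ 'n) set \<Rightarrow> bool" where
  "grid_set k A \<longleftrightarrow> (\<forall>x y. grid_index k x = grid_index k y \<longrightarrow> x \<in> A \<longrightarrow> y \<in> A)"

lemma mem_dyadic_cube_iff: "x \<in> dyadic_cube k j \<longleftrightarrow> grid_index k x = j"
proof -
  have *: "\<lfloor>x $ i / 2 powi k\<rfloor> = j $ i \<longleftrightarrow>
      of_int (j $ i) * 2 powi k \<le> x $ i \<and> x $ i < (of_int (j $ i) + 1) * 2 powi k" for i
    by (simp add: floor_eq_iff field_simps)
  show ?thesis
    by (simp add: dyadic_cube_def grid_index_def vec_eq_iff *)
qed

text \<open>Taking floors commutes with integer division by a positive power of 2, also for negative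
  indices, since \<open>div\<close> rounds downwards.\<close>

lemma grid_index_coarsen:
  "grid_index (k + int d) x $ c = grid_index k x $ c div 2 ^ d"
proof -
  have "x $ c / 2 powi (k + int d) = (x $ c / 2 powi k) / real_of_int (2 ^ d)"
    by (simp add: power_int_add)
  then show ?thesis
    by (simp only: grid_index_def vec_lambda_beta) (subst floor_divide_real_eq_div, auto)
qed

lemma grid_index_eq_mono:
  assumes "grid_index k x = grid_index k y" "k \<le> l"
  shows "grid_index l x = grid_index l y"
proof -
  obtain d where "l = k + int d" using assms(2) zle_iff_zadd by blast
  then show ?thesis using assms(1) by (simp add: vec_eq_iff grid_index_coarsen)
qed

lemma grid_setD: "grid_set k A \<Longrightarrow> x \<in> A \<Longrightarrow> grid_index k x = grid_index k y \<Longrightarrow> y \<in> A"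
  unfolding grid_set_def by blast

lemma grid_set_mono: "grid_set l A \<Longrightarrow> k \<le> l \<Longrightarrow> grid_set k A"
  unfolding grid_set_def using grid_index_eq_mono by blast

lemma grid_set_Int: "grid_set k A \<Longrightarrow> grid_set k B \<Longrightarrow> grid_set k (A \<inter> B)"
  unfolding grid_set_def by blast

lemma grid_set_dyadic_cube: "grid_set k (dyadic_cube k j)"
  by (auto simp: grid_set_def mem_dyadic_cube_iff)

lemma grid_set_even: "grid_set k {x. \<forall>c. even (grid_index k x $ c)}"
  by (auto simp: grid_set_def)

lemma grid_set_cube_cases:
  assumes "grid_set k A"
  obtains "dyadic_cube k j \<subseteq> A" | "dyadic_cube k j \<inter> A = {}"
proof (cases "dyadic_cube k j \<inter> A = {}")
  case False
  then obtain x where "x \<in> dyadic_cube k j" "x \<in> A" by blast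
  then have x: "grid_index k x = j" "x \<in> A" by (simp_all add: mem_dyadic_cube_iff)
  have "dyadic_cube k j \<subseteq> A"
  proof
    fix y assume "y \<in> dyadic_cube k j"
    then show "y \<in> A" using grid_setD[OF assms x(2)] x(1) by (simp add: mem_dyadic_cube_iff)
  qed
  then show thesis by (rule that(1))
qed (rule that(2))

section \<open>Measurability and measure of cubes and of their even parts\<close>

lemma borel_grid_index [measurable]:
  "(\<lambda>x. grid_index k x $ c) \<in> borel \<rightarrow>\<^sub>M count_space UNIV"
  unfolding grid_index_def by simp

lemma borel_even_set: "{x. \<forall>c. even (grid_index k x $ c)} \<in> sets (borel :: (real ^ 'n) measure)"
proof -
  have "{x. \<forall>c. even (grid_index k x $ c)}
     = (\<Inter>c. (\<lambda>x. grid_index k x $ c) -` {i. even i} \<inter> space borel :: (real ^ 'n) set)" by auto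
  also have "\<dots> \<in> sets borel"
    by (intro sets.countable_INT'' measurable_sets[OF borel_grid_index]) (auto simp: countable_finite)
  finally show ?thesis .
qed

lemma borel_dyadic_cube: "dyadic_cube k j \<in> sets (borel :: (real ^ 'n) measure)"
proof -
  have "dyadic_cube k j
     = (\<Inter>c. (\<lambda>x. grid_index k x $ c) -` {j $ c} \<inter> space borel :: (real ^ 'n) set)"
    by (auto simp: mem_dyadic_cube_iff vec_eq_iff)
  also have "\<dots> \<in> sets borel"
    by (intro sets.countable_INT'' measurable_sets[OF borel_grid_index]) (auto simp: countable_finite)
  finally show ?thesis .
qed

text \<open>The half-open cube lies between an open and a closed box with the same corners, and
  these have equal volume.\<close>

lemma
  fixes j :: "int ^ 'n"
  shows lmeasurable_dyadic_cube: "dyadic_cube k j \<in> lmeasurable"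
    and measure_dyadic_cube: "measure lebesgue (dyadic_cube k j) = (2 powi k) ^ CARD('n)"
proof -
  define a b :: "real ^ 'n" where "a = (\<chi> i. of_int (j $ i) * 2 powi k)"
    and "b = (\<chi> i. (of_int (j $ i) + 1) * 2 powi k)"
  have sub: "box a b \<subseteq> dyadic_cube k j" "dyadic_cube k j \<subseteq> cbox a b"
    by (auto simp: dyadic_cube_def a_def b_def mem_box_cart less_imp_le)
  show lm: "dyadic_cube k j \<in> lmeasurable"
    using borel_dyadic_cube[of k j] sub(2)
    by (intro bounded_set_imp_lmeasurable) (auto intro: bounded_subset[OF bounded_cbox])
  have "a $ i \<le> b $ i" for i by (simp add: a_def b_def)
  then have "measure lborel (cbox a b) = (2 powi k) ^ CARD('n)"
    by (subst content_cbox_cart) (auto simp: interval_ne_empty_cart a_def b_def algebra_simps)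
  then have c: "measure lebesgue (cbox a b) = (2 powi k) ^ CARD('n)"
    by (simp add: measure_completion)
  have bx: "measure lebesgue (box a b) = measure lebesgue (cbox a b)"
    by (simp add: measure_lborel_box_eq measure_lborel_cbox_eq)
  have "measure lebesgue (box a b) \<le> measure lebesgue (dyadic_cube k j)"
    by (rule measure_mono_fmeasurable[OF sub(1) _ lm]) simp
  moreover have "measure lebesgue (dyadic_cube k j) \<le> measure lebesgue (cbox a b)"
    by (rule measure_mono_fmeasurable[OF sub(2) fmeasurableD[OF lm] lmeasurable_cbox])
  ultimately
  show "measure lebesgue (dyadic_cube k j) = (2 powi k) ^ CARD('n)"
    using bx c by simp
qed

text \<open>Each cube of side \<open>2 powi k\<close> splits into 2^n half-size cubes, exactly one
  of which has only even indices. This is one step of the Cantor construction.\<close>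

lemma measure_even_part:
  fixes A :: "(real ^ 'n) set"
  assumes A: "A \<in> lmeasurable" and grid: "grid_set k A"
  shows "measure lebesgue A
       = 2 ^ CARD('n) * measure lebesgue (A \<inter> {x. \<forall>c. even (grid_index (k - 1) x $ c)})"
proof -
  define A' where "A' = A \<inter> {x. \<forall>c. even (grid_index (k - 1) x $ c)}"
  \<comment> \<open>\<open>A\<close> is tiled by the \<open>2 ^ n\<close> half-step translates of its even part.\<close>
  define w :: "bool ^ 'n \<Rightarrow> real ^ 'n" where "w e = (\<chi> c. if e $ c then 2 powi (k - 1) else 0)" for e
  \<comment> \<open>A shift by \<open>w e\<close> is a shift by one whole step of the finer grid in
    each coordinate selected by \<open>e\<close>.\<close>
  have w: "grid_index (k - 1) (w e + x) $ c = grid_index (k - 1) x $ c + of_bool (e $ c)" for e x c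
    by (simp add: grid_index_def w_def add_divide_distrib)
  have half: "grid_index k x $ c = grid_index (k - 1) x $ c div 2" for x :: "real ^ 'n" and c
    using grid_index_coarsen[of "k - 1" 1 x c] by simp
  have A': "A' \<in> lmeasurable"
    unfolding A'_def using A borel_even_set by (intro fmeasurable_Int_fmeasurable) auto
  have "A = (\<Union>e. (+) (w e) ` A')"
  proof (intro equalityI subsetI)
    fix x assume x: "x \<in> A"
    \<comment> \<open>The parities of the fine index of \<open>x\<close> tell which translate
      contains it; subtracting \<open>w e\<close> makes all indices even without leaving the coarse
      cube.\<close>
    define e :: "bool ^ 'n" where "e = (\<chi> c. odd (grid_index (k - 1) x $ c))"
    define y where "y = x - w e"
    have xy: "x = w e + y" by (simp add: y_def)
    have ev: "even (grid_index (k - 1) y $ c)" for c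
    proof -
      have "grid_index (k - 1) x $ c = grid_index (k - 1) y $ c + of_bool (e $ c)"
        using w[of e y c] xy by simp
      moreover have "e $ c = odd (grid_index (k - 1) x $ c)" by (simp add: e_def)
      ultimately show ?thesis by (cases "e $ c") auto
    qed
    have "grid_index k x = grid_index k y"
      using ev w[of e y] by (auto simp: vec_eq_iff half xy[symmetric])
    then have "y \<in> A" using grid_setD[OF grid x] by simp
    then have "y \<in> A'" using ev by (simp add: A'_def)
    then show "x \<in> (\<Union>e. (+) (w e) ` A')" using xy by blast
  next
    fix x assume "x \<in> (\<Union>e. (+) (w e) ` A')"
    then obtain e y where y: "y \<in> A'" "x = w e + y" by blast
    have "grid_index k y = grid_index k x"
      using y(1) w[of e y] by (simp add: y(2) A'_def) (auto simp: vec_eq_iff half)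
    then show "x \<in> A" using y grid_setD[OF grid, of y x] by (simp add: A'_def)
  qed
  moreover have "measure lebesgue (\<Union>e. (+) (w e) ` A') = (\<Sum>e\<in>UNIV. measure lebesgue ((+) (w e) ` A'))"
  proof (rule measure_finite_Union)
    show "disjoint_family (\<lambda>e. (+) (w e) ` A')"
    proof -
      have "e = e'" if xe: "x \<in> (+) (w e) ` A'" "x \<in> (+) (w e') ` A'" for e e' x
      proof -
        obtain y y' where y: "y \<in> A'" "y' \<in> A'" "x = w e + y" "x = w e' + y'"
          using xe by blast
        have "odd (grid_index (k - 1) (w e + y) $ c) = e $ c" if "y \<in> A'" for e y c
          using w[of e y c] that by (auto simp: A'_def)
        from this[OF y(1), of e] this[OF y(2), of e'] have "e $ c = e' $ c" for c
          unfolding y(3,4)[symmetric] by metis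
        then show ?thesis by (simp add: vec_eq_iff)
      qed
      then show ?thesis unfolding disjoint_family_on_def by blast
    qed
    have tr: "(+) (w e) ` A' \<in> lmeasurable" for e
      by (rule measurable_translation[OF A'])
    show "range (\<lambda>e. (+) (w e) ` A') \<subseteq> sets lebesgue"
      using fmeasurableD[OF tr] by blast
    show "emeasure lebesgue ((+) (w e) ` A') \<noteq> \<infinity>" for e
      unfolding infinity_ennreal_def by (rule fmeasurableD2[OF tr])
  qed simp
  ultimately show ?thesis
    by (simp add: measure_translation A'_def CARD_vec)
qed

subsection \<open>The Cantor-type sets\<close>

text \<open>For \<open>r\<close> = n/\<gamma>, the side \<open>2 powi (- level_exp r m)\<close> to
  the power \<gamma> is comparable to 2^(-nm), the measure of stage \<open>m\<close>; rounding down
  costs at most a factor \<open>2 powr \<gamma>\<close>.\<close>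

definition level_exp :: "real \<Rightarrow> nat \<Rightarrow> int" where
  "level_exp r m = \<lfloor>real m * r\<rfloor>"

\<comment> \<open>Points of the unit cube all of whose coordinates have zero binary digits at the positions
  \<open>level_exp r i + 1\<close>, \<open>i < m\<close>. With \<open>r = n / \<gamma>\<close> the cubes of side \<open>2 powi (- level_exp r m)\<close>
  in \<open>sparse_set r m\<close> number about \<open>2 ^ ((n - \<gamma>) * level_exp r m)\<close>.\<close>
primrec sparse_set :: "real \<Rightarrow> nat \<Rightarrow> (real ^ 'n) set" where
  "sparse_set r 0 = dyadic_cube 0 0"
| "sparse_set r (Suc m) =
     sparse_set r m \<inter> {x. \<forall>c. even (grid_index (- level_exp r m - 1) x $ c)}"

lemma level_exp_0 [simp]: "level_exp r 0 = 0"
  by (simp add: level_exp_def)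

text \<open>This is where \<gamma> \<le> n enters: consecutive stages are at least one binary digit
  apart, which leaves room for the halving between them.\<close>

lemma level_exp_Suc:
  assumes "1 \<le> r" shows "level_exp r m + 1 \<le> level_exp r (Suc m)"
proof -
  have "real m * r + 1 \<le> real (Suc m) * r" using assms by (simp add: algebra_simps)
  then have "\<lfloor>real m * r + 1\<rfloor> \<le> \<lfloor>real (Suc m) * r\<rfloor>" by (rule floor_mono)
  then show ?thesis by (simp add: level_exp_def)
qed

lemma level_exp_strict_mono: "1 \<le> r \<Longrightarrow> strict_mono (level_exp r)"
  using level_exp_Suc[of r] by (intro strict_monoI_Suc) (simp add: add1_zle_eq)

lemma level_exp_ge: "1 \<le> r \<Longrightarrow> int m \<le> level_exp r m"
proof (induction m)
  case (Suc m)
  then show ?case using level_exp_Suc[of r m] by linarith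
qed simp


lemma grid_set_sparse:
  assumes "1 \<le> r"
  shows "grid_set (- level_exp r m) (sparse_set r m :: (real ^ 'n) set)"
proof (induction m)
  case 0
  then show ?case by (simp add: grid_set_dyadic_cube)
next
  case (Suc m)
  have "grid_set (- level_exp r m - 1) (sparse_set r (Suc m) :: (real ^ 'n) set)"
    unfolding sparse_set.simps
    by (intro grid_set_Int grid_set_even grid_set_mono[OF Suc.IH]) auto
  then show ?case by (rule grid_set_mono) (use level_exp_Suc[OF assms, of m] in auto)
qed

lemma borel_sparse_set: "sparse_set r m \<in> sets (borel :: (real ^ 'n) measure)"
  by (induction m) (auto intro: borel_dyadic_cube borel_even_set)

lemma sparse_set_antimono: "i \<le> j \<Longrightarrow> sparse_set r j \<subseteq> sparse_set r i"
  by (rule lift_Suc_antimono_le[of "sparse_set r"]) auto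

lemma lmeasurable_sparse_set: "(sparse_set r m :: (real ^ 'n) set) \<in> lmeasurable"
proof (rule fmeasurableI2[of "dyadic_cube 0 0"])
  show "sparse_set r m \<subseteq> (dyadic_cube 0 0 :: (real ^ 'n) set)"
    using sparse_set_antimono[of 0 m r] by simp
qed (use borel_sparse_set[of r m] lmeasurable_dyadic_cube in \<open>auto intro: sets_completionI_sets\<close>)

text \<open>Once \<open>A\<close> is a union of cubes of stage \<open>m\<close>, each further stage
  keeps exactly the fraction 2^(-n) of it. The Cantor mass of \<open>A\<close> can thus be read off
  at any later stage.\<close>

lemma measure_Int_sparse_set:
  fixes A :: "(real ^ 'n) set"
  assumes "1 \<le> r" "A \<in> lmeasurable" "grid_set (- level_exp r m) A"
  shows "measure lebesgue (A \<inter> sparse_set r m)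
       = 2 ^ (CARD('n) * d) * measure lebesgue (A \<inter> sparse_set r (m + d))"
proof (induction d)
  case (Suc d)
  have "level_exp r m \<le> level_exp r (m + d)"
    using level_exp_strict_mono[OF assms(1)] by (simp add: strict_mono_less_eq)
  then have "grid_set (- level_exp r (m + d)) (A \<inter> sparse_set r (m + d))"
    by (intro grid_set_Int grid_set_sparse assms grid_set_mono[OF assms(3)]) auto
  moreover have "A \<inter> sparse_set r (m + d) \<in> lmeasurable"
    using assms(2) lmeasurable_sparse_set by (intro fmeasurable.Int) auto
  ultimately have "measure lebesgue (A \<inter> sparse_set r (m + d))
      = 2 ^ CARD('n) * measure lebesgue (A \<inter> sparse_set r (m + Suc d))"
    using measure_even_part[of "A \<inter> sparse_set r (m + d)" "- level_exp r (m + d)"]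
    by (simp add: Int_assoc)
  then show ?case using Suc by (simp add: power_add mult_ac)
qed simp

lemma measure_sparse_set:
  assumes "1 \<le> r"
  shows "measure lebesgue (sparse_set r m :: (real ^ 'n) set) = 1 / 2 ^ (CARD('n) * m)"
proof -
  have "measure lebesgue (dyadic_cube 0 0 \<inter> sparse_set r 0 :: (real ^ 'n) set)
      = 2 ^ (CARD('n) * m) * measure lebesgue (dyadic_cube 0 0 \<inter> sparse_set r (0 + m) :: (real ^ 'n) set)"
    by (rule measure_Int_sparse_set[OF assms lmeasurable_dyadic_cube]) (simp add: grid_set_dyadic_cube)
  moreover have "dyadic_cube 0 0 \<inter> sparse_set r m = (sparse_set r m :: (real ^ 'n) set)"
    using sparse_set_antimono[of 0 m r] by auto
  ultimately show ?thesis by (simp add: measure_dyadic_cube field_simps)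
qed

lemma measure_dyadic_cube_pos: "0 < measure lebesgue (dyadic_cube k j :: (real ^ 'n) set)"
  by (simp add: measure_dyadic_cube)

subsection \<open>Oscillations and norms of the test functions\<close>

lemma mean_osc_nonneg: "0 \<le> mean_osc f Q"
  unfolding mean_osc_def set_lebesgue_integral_def
  by (intro mult_nonneg_nonneg Bochner_Integration.integral_nonneg) auto

text \<open>The mean differs from \<open>a\<close> by at most the average of |f - a|, so replacing
  the mean by an arbitrary constant costs a factor 2.\<close>

lemma mean_osc_le:
  fixes Q :: "(real ^ 'n) set"
  assumes Q: "Q \<in> lmeasurable" "0 < measure lebesgue Q" and f: "set_integrable lebesgue Q f"
  shows "measure lebesgue Q * mean_osc f Q \<le> 2 * (LINT x:Q|lebesgue. \<bar>f x - a\<bar>)"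
proof -
  define M where "M = mean_value f Q"
  have const: "set_integrable lebesgue Q (\<lambda>x. c)" "(LINT x:Q|lebesgue. c) = measure lebesgue Q * c" for c :: real
    unfolding set_integrable_def set_lebesgue_integral_def
    using Q(1) by (simp_all add: lmeasurable_iff_integrable fmeasurableD)
  note int = set_integral_diff[OF f const(1)]
  have absint: "set_integrable lebesgue Q (\<lambda>x. \<bar>f x - c\<bar>)" for c
    by (rule set_integrable_abs[OF int(1)])
  have "measure lebesgue Q * (M - a) = (LINT x:Q|lebesgue. f x - a)"
    using Q(2) by (simp add: int(2) const(2) M_def mean_value_def right_diff_distrib)
  then have "measure lebesgue Q * \<bar>M - a\<bar> = \<bar>LINT x:Q|lebesgue. f x - a\<bar>"
    by (metis abs_mult abs_of_nonneg measure_nonneg)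
  also have "\<dots> \<le> (LINT x:Q|lebesgue. \<bar>f x - a\<bar>)"
    using set_integral_norm_bound[OF int(1), of a] by simp
  finally have 1: "measure lebesgue Q * \<bar>M - a\<bar> \<le> (LINT x:Q|lebesgue. \<bar>f x - a\<bar>)" .
  have "measure lebesgue Q * mean_osc f Q = (LINT x:Q|lebesgue. \<bar>f x - M\<bar>)"
    using Q(2) by (simp add: mean_osc_def M_def)
  also have "\<dots> \<le> (LINT x:Q|lebesgue. \<bar>f x - a\<bar> + \<bar>M - a\<bar>)"
    by (intro set_integral_mono set_integral_add absint const) auto
  also have "\<dots> = (LINT x:Q|lebesgue. \<bar>f x - a\<bar>) + measure lebesgue Q * \<bar>M - a\<bar>"
    by (simp add: set_integral_add(2)[OF absint const(1)] const(2))
  finally show ?thesis using 1 by linarith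
qed

lemma ennreal_powr_mono: "x \<le> y \<Longrightarrow> 0 \<le> a \<Longrightarrow> ennreal_powr x a \<le> ennreal_powr y a"
proof (cases "y = top")
  case False
  assume "x \<le> y" "0 \<le> a"
  with False have "x \<noteq> top" "enn2real x \<le> enn2real y"
    by (auto simp: top_unique intro: enn2real_mono simp: top.not_eq_extremum)
  then show ?thesis
    using False \<open>0 \<le> a\<close> by (simp add: ennreal_powr_def ennreal_leI powr_mono2)
qed (simp add: ennreal_powr_def)

lemma ennreal_powr_ennreal: "0 \<le> u \<Longrightarrow> ennreal_powr (ennreal u) a = ennreal (u powr a)"
  by (simp add: ennreal_powr_def)

section \<open>The layered test functions and upper bounds for their norms\<close>

lemma sum_power_shift_le:
  fixes q :: real
  assumes "0 \<le> q" "q < 1"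
  shows "(\<Sum>i=m..K. q ^ (i - m)) \<le> 1 / (1 - q)"
proof -
  have "(\<Sum>i=m..K. q ^ (i - m)) = (\<Sum>d<Suc K - m. q ^ d)"
    by (rule sum.reindex_bij_witness[of _ "\<lambda>d. d + m" "\<lambda>i. i - m"]) auto
  also have "\<dots> \<le> (\<Sum>d. q ^ d)"
    using assms by (intro sum_le_suminf summable_geometric) auto
  also have "\<dots> = 1 / (1 - q)"
    using assms by (intro suminf_geometric) auto
  finally show ?thesis .
qed

\<comment> \<open>Used with \<open>w = 2 powr (n / p)\<close>, which makes \<open>(w ^ m) powr p\<close> times the measure of \<open>sparse_set r m\<close> equal to 1.\<close>
definition tower :: "real \<Rightarrow> real \<Rightarrow> nat \<Rightarrow> real ^ 'n \<Rightarrow> real" where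
  "tower r w K x = (\<Sum>i\<le>K. w ^ i * indicator (sparse_set r i) x)"

lemma integrable_tower: "integrable lebesgue (tower r w K :: real ^ 'n \<Rightarrow> real)"
  unfolding tower_def
  by (intro Bochner_Integration.integrable_sum integrable_mult_right
      lmeasurable_sparse_set[unfolded lmeasurable_iff_integrable])

lemma set_integrable_tower:
  "A \<in> sets lebesgue \<Longrightarrow> set_integrable lebesgue A (tower r w K :: real ^ 'n \<Rightarrow> real)"
  unfolding set_integrable_def by (intro integrable_mult_indicator integrable_tower)

lemma locally_integrable_tower: "locally_integrable (tower r w K :: real ^ 'n \<Rightarrow> real)"
  unfolding locally_integrable_def
  by (intro allI impI set_integrable_tower fmeasurableD lmeasurable_compact)

lemma pow_powr_swap: "0 < w \<Longrightarrow> (w ^ m) powr p = (w powr p) ^ m" for w :: real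
  by (simp add: powr_power powr_realpow[symmetric] powr_powr mult.commute)

text \<open>The two bounds control two geometric series: \<open>w > 1\<close> lets the last layer
  dominate the values of the tower, and \<open>w < 2 ^ n\<close>, which relies on p > 1, lets the
  first layer dominate its integrals.\<close>

lemma
  fixes w p :: real
  assumes p: "1 < p" and w: "0 < w" "w powr p = 2 ^ n" and n: "0 < n"
  shows weight_gt_1: "1 < w" and weight_less: "w < 2 ^ n"
proof -
  show w1: "1 < w"
  proof (rule ccontr)
    assume "\<not> 1 < w"
    then have "w powr p \<le> 1" using w p by (intro powr_le1) auto
    moreover have "(1::real) < 2 ^ n" using n by (intro one_less_power) auto
    ultimately show False using w by simp
  qed
  have "w powr 1 < w powr p" using w1 p by (intro powr_less_mono) auto
  then show "w < 2 ^ n" using w by simp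
qed

text \<open>The right-hand side is a constant times the measure that spreads mass 1 uniformly over
  \<open>sparse_set r K\<close>, evaluated at \<open>Q\<close>; hence it sums to a constant over disjoint cubes.\<close>

lemma tower_osc_powr_le:
  fixes j :: "int ^ 'n" and k :: int
  assumes r: "1 \<le> r" and p: "1 < p" and w: "0 < w" "w powr p = 2 ^ CARD('n)"
  defines "Q \<equiv> dyadic_cube k j" and "B \<equiv> 2 / (1 - w / 2 ^ CARD('n))"
  shows "measure lebesgue Q * mean_osc (tower r w K) Q powr p
       \<le> B powr p * 2 ^ (CARD('n) * K) * measure lebesgue (Q \<inter> sparse_set r K)"
proof -
  define q where "q = w / 2 ^ CARD('n)"
  define \<mu> where "\<mu> i = measure lebesgue (Q \<inter> sparse_set r i)" for i
  define O' where "O' = mean_osc (tower r w K) Q"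
  have q: "0 < q" "q < 1" using weight_less[OF p w zero_less_card_finite] w by (simp_all add: q_def)
  have Q: "Q \<in> lmeasurable" "0 < measure lebesgue Q" "grid_set k Q"
    by (simp_all add: Q_def lmeasurable_dyadic_cube measure_dyadic_cube_pos grid_set_dyadic_cube)
  have B: "0 < B" using q by (simp add: B_def q_def)
  have O: "0 \<le> O'" by (simp add: O'_def mean_osc_nonneg)
  \<comment> \<open>The stage \<open>m\<close> sought is the first one whose cubes are no larger
    than \<open>Q\<close>; from there on \<open>Q\<close> is a union of cubes of the stage.\<close>
  have "\<exists>m. - level_exp r m \<le> k"
    using level_exp_ge[OF r, of "nat (- k)"] by (intro exI[of _ "nat (- k)"]) linarith
  then obtain m where "- level_exp r m \<le> k" "\<forall>i<m. \<not> - level_exp r i \<le> k"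
    using exists_least_iff[of "\<lambda>m. - level_exp r m \<le> k"] by blast
  then have m: "- level_exp r m \<le> k" "\<And>i. i < m \<Longrightarrow> k < - level_exp r i" by (auto simp: not_le)
  have "Q \<noteq> {}" using Q(2) by auto
  then obtain x0 where x0: "x0 \<in> Q" by blast
  \<comment> \<open>The layers coarser than \<open>Q\<close> are constant on \<open>Q\<close> and do not contribute to the oscillation.\<close>
  define a where "a = (\<Sum>i\<in>{..K} \<inter> {..<m}. w ^ i * indicator (sparse_set r i) x0)"
  have same: "indicator (sparse_set r i) x = (indicator (sparse_set r i) x0 :: real)"
    if "x \<in> Q" "i < m" for x i
  proof -
    have "grid_set k (sparse_set r i :: (real ^ 'n) set)"
      using grid_set_mono[OF grid_set_sparse[OF r]] m(2)[OF that(2)] by (meson less_imp_le)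
    moreover have "grid_index k x = grid_index k x0"
      using that x0 by (simp add: Q_def mem_dyadic_cube_iff)
    ultimately have "x \<in> sparse_set r i \<longleftrightarrow> x0 \<in> sparse_set r i"
      using grid_setD by metis
    then show ?thesis by (simp add: indicator_def)
  qed
  have diff: "tower r w K x - a = (\<Sum>i=m..K. w ^ i * indicator (sparse_set r i) x)" if "x \<in> Q" for x
  proof -
    have "a = (\<Sum>i\<in>{..K} \<inter> {..<m}. w ^ i * indicator (sparse_set r i) x)"
      unfolding a_def using same[OF that] by (intro sum.cong) auto
    moreover have "tower r w K x = (\<Sum>i\<in>{..K} \<inter> {..<m} \<union> {m..K}. w ^ i * indicator (sparse_set r i) x)"
      unfolding tower_def by (intro sum.cong) auto
    moreover have "\<dots> = (\<Sum>i\<in>{..K} \<inter> {..<m}. w ^ i * indicator (sparse_set r i) x)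
        + (\<Sum>i=m..K. w ^ i * indicator (sparse_set r i) x)"
      by (intro sum.union_disjoint) auto
    ultimately show ?thesis by simp
  qed
  have "indicator Q x *\<^sub>R \<bar>tower r w K x - a\<bar> = (\<Sum>i=m..K. w ^ i * indicator (Q \<inter> sparse_set r i) x)" for x
  proof (cases "x \<in> Q")
    case True
    have "0 \<le> (\<Sum>i=m..K. w ^ i * indicator (sparse_set r i) x)"
      using w by (intro sum_nonneg) auto
    with True show ?thesis by (simp add: diff indicator_inter_arith)
  qed simp
  then have "(LINT x:Q|lebesgue. \<bar>tower r w K x - a\<bar>)
      = (LINT x|lebesgue. (\<Sum>i=m..K. w ^ i * indicator (Q \<inter> sparse_set r i) x))"
    unfolding set_lebesgue_integral_def by (simp only:)
  also have "\<dots> = (\<Sum>i=m..K. LINT x|lebesgue. w ^ i * indicator (Q \<inter> sparse_set r i) x)"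
    by (intro Bochner_Integration.integral_sum integrable_mult_right
        fmeasurable.Int[OF Q(1) lmeasurable_sparse_set, unfolded lmeasurable_iff_integrable])
  also have "\<dots> = (\<Sum>i=m..K. w ^ i * \<mu> i)"
    by (simp add: \<mu>_def del: indicator_inter_arith)
  finally have upper: "measure lebesgue Q * O' \<le> 2 * (\<Sum>i=m..K. w ^ i * \<mu> i)"
    using mean_osc_le[OF Q(1,2) set_integrable_tower[OF fmeasurableD[OF Q(1)]], of r w K a]
    by (simp add: O'_def)
  have \<mu>: "\<mu> m = 2 ^ (CARD('n) * d) * \<mu> (m + d)" for d
    unfolding \<mu>_def
    by (rule measure_Int_sparse_set[OF r Q(1)]) (use grid_set_mono[OF Q(3) m(1)] in simp)
  show ?thesis
  proof (cases "m \<le> K")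
    case False
    then have "O' \<le> 0" using upper Q(2) by (simp add: mult_le_0_iff)
    then have "O' = 0" using O by simp
    then show ?thesis by (simp add: O'_def)
  next
    case True
    \<comment> \<open>From one layer to the next the weight grows by \<open>w\<close> and the
      measure shrinks by 2^n, so the integrals decay with ratio \<open>q\<close>.\<close>
    have "w ^ i * \<mu> i = w ^ m * \<mu> m * q ^ (i - m)" if "i \<in> {m..K}" for i
    proof -
      have "w ^ i = w ^ m * w ^ (i - m)" using that by (simp flip: power_add)
      moreover have "\<mu> m = 2 ^ (CARD('n) * (i - m)) * \<mu> i" using \<mu>[of "i - m"] that by simp
      ultimately show ?thesis by (simp add: q_def power_divide power_mult)
    qed
    then have "(\<Sum>i=m..K. w ^ i * \<mu> i) = w ^ m * \<mu> m * (\<Sum>i=m..K. q ^ (i - m))"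
      unfolding sum_distrib_left by (rule sum.cong[OF refl])
    also have "\<dots> \<le> w ^ m * \<mu> m * (1 / (1 - q))"
      using w q by (intro mult_left_mono sum_power_shift_le) (auto simp: \<mu>_def)
    finally have "measure lebesgue Q * O' \<le> B * w ^ m * \<mu> m"
      using upper by (simp add: B_def q_def)
    define \<rho> where "\<rho> = \<mu> m / measure lebesgue Q"
    have "\<mu> m \<le> measure lebesgue Q"
      unfolding \<mu>_def using Q lmeasurable_sparse_set
      by (intro measure_mono_fmeasurable) (auto dest: fmeasurableD)
    then have \<rho>: "0 \<le> \<rho>" "\<rho> \<le> 1" using Q by (simp_all add: \<rho>_def \<mu>_def)
    have "O' \<le> B * w ^ m * \<rho>"
      using \<open>measure lebesgue Q * O' \<le> B * w ^ m * \<mu> m\<close> Q(2) by (simp add: \<rho>_def field_simps)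
    then have "O' powr p \<le> (B * w ^ m * \<rho>) powr p"
      using O p by (intro powr_mono2) auto
    also have "\<dots> = B powr p * (w ^ m) powr p * \<rho> powr p"
      using B w \<rho> by (simp add: powr_mult)
    also have "(w ^ m) powr p = 2 ^ (CARD('n) * m)" using w by (simp add: pow_powr_swap power_mult)
    \<comment> \<open>A density is at most 1, so its p-th power is at most itself; this makes the
      bound additive in \<open>Q\<close>.\<close>
    also have "B powr p * 2 ^ (CARD('n) * m) * \<rho> powr p \<le> B powr p * 2 ^ (CARD('n) * m) * \<rho>"
      using \<rho> p powr_mono'[of 1 p \<rho>] by (intro mult_left_mono) auto
    finally have "measure lebesgue Q * O' powr p \<le> measure lebesgue Q * (B powr p * 2 ^ (CARD('n) * m) * \<rho>)"
      using Q by (intro mult_left_mono) auto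
    also have "\<dots> = B powr p * 2 ^ (CARD('n) * m) * \<mu> m" using Q by (simp add: \<rho>_def)
    \<comment> \<open>Passing to stage \<open>K\<close> removes \<open>m\<close> from the bound, so
      that cubes of all sizes are compared with one measure.\<close>
    also have "\<mu> m = 2 ^ (CARD('n) * (K - m)) * \<mu> K" using \<mu>[of "K - m"] True by simp
    also have "B powr p * 2 ^ (CARD('n) * m) * (2 ^ (CARD('n) * (K - m)) * \<mu> K)
        = B powr p * 2 ^ (CARD('n) * m + CARD('n) * (K - m)) * \<mu> K"
      by (simp add: power_add)
    also have "CARD('n) * m + CARD('n) * (K - m) = CARD('n) * K"
      using True by (simp flip: add_mult_distrib2)
    finally show ?thesis by (simp add: O'_def \<mu>_def)
  qed
qed

lemma JN_norm_tower_le: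
  assumes r: "1 \<le> r" and p: "1 < p" and w: "0 < w" "w powr p = 2 ^ CARD('n)"
  shows "JN_norm p (tower r w K :: real ^ 'n \<Rightarrow> real) \<le> ennreal (2 / (1 - w / 2 ^ CARD('n)))"
proof -
  define B where "B = 2 / (1 - w / 2 ^ CARD('n))"
  have "(\<Sum>\<^sub>\<infinity>Q\<in>P. emeasure lebesgue Q * ennreal (mean_osc (tower r w K) Q powr p)) \<le> ennreal (B powr p)"
    if P: "P \<subseteq> dyadic_cubes" "disjoint P" for P :: "(real ^ 'n) set set"
  \<comment> \<open>The sum over \<open>P\<close> is the supremum of its finite partial sums. In
    each of these the disjoint pieces of \<open>sparse_set r K\<close> have total measure at most
    that of the whole set.\<close>
  proof (subst nonneg_infsum_complete, simp, intro SUP_least)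
    fix F assume "F \<in> {F. finite F \<and> F \<subseteq> P}"
    then have F: "finite F" "F \<subseteq> P" by auto
    have cube: "\<exists>k j. Q = dyadic_cube k j" if "Q \<in> F" for Q
      using that F P by (auto simp: dyadic_cubes_def)
    have cubeD: "Q \<in> lmeasurable"
      "measure lebesgue Q * mean_osc (tower r w K) Q powr p
        \<le> B powr p * 2 ^ (CARD('n) * K) * measure lebesgue (Q \<inter> sparse_set r K)" if "Q \<in> F" for Q
      using cube[OF that] lmeasurable_dyadic_cube tower_osc_powr_le[OF r p w, folded B_def] by blast+
    have fin: "Q \<inter> sparse_set r K \<in> lmeasurable" if "Q \<in> F" for Q
      using cubeD(1)[OF that] lmeasurable_sparse_set by (rule fmeasurable.Int)
    have "(\<Sum>Q\<in>F. measure lebesgue (Q \<inter> sparse_set r K)) = measure lebesgue (\<Union>Q\<in>F. Q \<inter> sparse_set r K)"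
    proof (rule measure_finite_Union[symmetric])
      show "disjoint_family_on (\<lambda>Q. Q \<inter> sparse_set r K) F"
        using P(2) F(2) unfolding disjoint_family_on_def disjoint_def by blast
      show "emeasure lebesgue (Q \<inter> sparse_set r K) \<noteq> \<infinity>" if "Q \<in> F" for Q
        unfolding infinity_ennreal_def by (rule fmeasurableD2[OF fin[OF that]])
    qed (use F(1) fmeasurableD[OF fin] in blast)+
    also have "\<dots> \<le> measure lebesgue (sparse_set r K :: (real ^ 'n) set)"
      using F(1) fmeasurableD[OF fin]
      by (intro measure_mono_fmeasurable lmeasurable_sparse_set sets.finite_UN) blast+
    finally have meas: "(\<Sum>Q\<in>F. measure lebesgue (Q \<inter> sparse_set r K)) \<le> 1 / 2 ^ (CARD('n) * K)"
      by (simp add: measure_sparse_set[OF r])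
    have "(\<Sum>Q\<in>F. emeasure lebesgue Q * ennreal (mean_osc (tower r w K) Q powr p))
        = (\<Sum>Q\<in>F. ennreal (measure lebesgue Q * mean_osc (tower r w K) Q powr p))"
      by (intro sum.cong refl, subst emeasure_eq_measure2[OF cubeD(1)], simp, subst ennreal_mult) auto
    also have "\<dots> = ennreal (\<Sum>Q\<in>F. measure lebesgue Q * mean_osc (tower r w K) Q powr p)"
      by (rule sum_ennreal) simp
    also have "\<dots> \<le> ennreal (\<Sum>Q\<in>F. B powr p * 2 ^ (CARD('n) * K) * measure lebesgue (Q \<inter> sparse_set r K))"
      by (intro ennreal_leI sum_mono cubeD(2))
    also have "\<dots> \<le> ennreal (B powr p)"
      using mult_left_mono[OF meas, of "B powr p * 2 ^ (CARD('n) * K)"]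
      by (intro ennreal_leI) (simp add: sum_distrib_left)
    finally show "(\<Sum>Q\<in>F. emeasure lebesgue Q * ennreal (mean_osc (tower r w K) Q powr p)) \<le> ennreal (B powr p)" .
  qed
  then have "JN_norm p (tower r w K :: real ^ 'n \<Rightarrow> real) \<le> ennreal_powr (ennreal (B powr p)) (1 / p)"
    unfolding JN_norm_def using p by (intro ennreal_powr_mono SUP_least) auto
  also have "\<dots> = ennreal B"
    using p weight_less[OF p w zero_less_card_finite] by (simp add: ennreal_powr_ennreal powr_powr B_def)
  finally show ?thesis by (simp add: B_def)
qed

text \<open>Only the layers up to \<open>m\<close> can be nonzero at \<open>x\<close>, and their
  geometric sum is at most a constant times its last term.\<close>

lemma tower_le:
  assumes w: "1 < w" and x: "\<And>i. m < i \<Longrightarrow> i \<le> K \<Longrightarrow> x \<notin> sparse_set r i"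
  shows "tower r w K x \<le> w / (w - 1) * w ^ m"
proof -
  have "tower r w K x \<le> (\<Sum>i\<le>m. w ^ i)"
  proof -
    have "tower r w K x = (\<Sum>i\<in>{..K} \<inter> {..m}. w ^ i * indicator (sparse_set r i) x)"
      unfolding tower_def using x by (intro sum.mono_neutral_right) (auto simp: not_le)
    also have "\<dots> \<le> (\<Sum>i\<in>{..K} \<inter> {..m}. w ^ i)"
      using w by (intro sum_mono) (auto simp: indicator_def)
    also have "\<dots> \<le> (\<Sum>i\<le>m. w ^ i)"
      using w by (intro sum_mono2) auto
    finally show ?thesis .
  qed
  also have "\<dots> = (w ^ Suc m - 1) / (w - 1)"
    using w geometric_sum[of w "Suc m"] by (simp add: lessThan_Suc_atMost)
  also have "\<dots> \<le> w ^ Suc m / (w - 1)"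
    using w by (intro divide_right_mono) auto
  finally show ?thesis by simp
qed

text \<open>Let \<open>j\<close> be the deepest stage containing the superlevel set. A point of that
  set lying in no later layer forces l \<le> B w^j, while the set has measure at most 2^(-nj); the
  choice of \<open>w\<close> makes the powers cancel.\<close>

lemma weak_Lp_norm_tower_le:
  assumes r: "1 \<le> r" and p: "1 < p" and w: "0 < w" "w powr p = 2 ^ CARD('n)"
  shows "weak_Lp_norm p (tower r w K :: real ^ 'n \<Rightarrow> real) \<le> ennreal (w / (w - 1))"
proof -
  let ?f = "tower r w K :: real ^ 'n \<Rightarrow> real"
  define B where "B = w / (w - 1)"
  have w1: "1 < w" by (rule weight_gt_1[OF p w zero_less_card_finite])
  have nonneg: "0 \<le> ?f x" for x unfolding tower_def using w by (intro sum_nonneg) auto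
  have "ennreal (l powr p) * emeasure lebesgue {x. \<bar>?f x\<bar> > l} \<le> ennreal (B powr p)" if l: "0 < l" for l
  proof (cases "{x. \<bar>?f x\<bar> > l} = {}")
    case False
    let ?P = "\<lambda>j. j \<le> K \<and> {x. \<bar>?f x\<bar> > l} \<subseteq> sparse_set r j"
    have "?P 0"
    proof -
      have "?f x = 0" if "x \<notin> sparse_set r 0" for x
        using that sparse_set_antimono[of 0 _ r] unfolding tower_def by (intro sum.neutral) (auto simp: indicator_def)
      then show ?thesis using l by fastforce
    qed
    define j where "j = (GREATEST j. ?P j)"
    have j: "j \<le> K" "{x. \<bar>?f x\<bar> > l} \<subseteq> sparse_set r j"
      using GreatestI_nat[of ?P 0 K, OF \<open>?P 0\<close>] by (simp_all add: j_def)
    have "\<exists>x. l < ?f x \<and> (\<forall>i. j < i \<longrightarrow> i \<le> K \<longrightarrow> x \<notin> sparse_set r i)"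
    \<comment> \<open>For \<open>j = K\<close> no later layer exists and any point of the superlevel
      set will do; otherwise maximality of \<open>j\<close> supplies a point outside stage
      \<open>Suc j\<close>.\<close>
    proof (cases "j = K")
      case True
      then show ?thesis using False nonneg by auto
    next
      case False
      then have "\<not> ?P (Suc j)"
        using Greatest_le_nat[of ?P "Suc j" K] by (auto simp: j_def)
      then obtain x where "l < ?f x" "x \<notin> sparse_set r (Suc j)"
        using False j(1) nonneg by auto
      then show ?thesis using sparse_set_antimono[of "Suc j" _ r] by (metis Suc_leI subsetD)
    qed
    then obtain x where "l < ?f x" "\<And>i. j < i \<Longrightarrow> i \<le> K \<Longrightarrow> x \<notin> sparse_set r i" by blast
    then have "l \<le> B * w ^ j" using tower_le[OF w1, of j K x r] by (simp add: B_def)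
    then have "l powr p \<le> (B * w ^ j) powr p" using l p by (intro powr_mono2) auto
    also have "\<dots> = B powr p * 2 ^ (CARD('n) * j)"
      using w1 w by (simp add: powr_mult pow_powr_swap power_mult)
    finally have lp: "l powr p \<le> B powr p * 2 ^ (CARD('n) * j)" .
    have "emeasure lebesgue {x. \<bar>?f x\<bar> > l} \<le> emeasure lebesgue (sparse_set r j :: (real ^ 'n) set)"
      using j(2) fmeasurableD[OF lmeasurable_sparse_set] by (intro emeasure_mono)
    also have "\<dots> = ennreal (1 / 2 ^ (CARD('n) * j))"
      by (subst emeasure_eq_measure2[OF lmeasurable_sparse_set]) (simp only: measure_sparse_set[OF r])
    finally have "ennreal (l powr p) * emeasure lebesgue {x. \<bar>?f x\<bar> > l}
        \<le> ennreal (B powr p * 2 ^ (CARD('n) * j)) * ennreal (1 / 2 ^ (CARD('n) * j))"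
      using lp by (intro mult_mono ennreal_leI) auto
    also have "\<dots> = ennreal (B powr p)"
      by (simp flip: ennreal_mult)
    finally show ?thesis .
  qed simp
  then have "weak_Lp_norm p ?f \<le> ennreal_powr (ennreal (B powr p)) (1 / p)"
    unfolding weak_Lp_norm_def using p by (intro ennreal_powr_mono SUP_least) auto
  also have "\<dots> = ennreal B"
    using p w1 by (simp add: ennreal_powr_ennreal powr_powr B_def)
  finally show ?thesis by (simp add: B_def)
qed

section \<open>Lower bound for the weak sequence norm\<close>

lemma set_integral_ge_const:
  fixes g :: "real ^ 'n \<Rightarrow> real"
  assumes Q: "Q \<in> lmeasurable" and R: "R \<in> lmeasurable" "R \<subseteq> Q"
    and g: "set_integrable lebesgue Q g" "\<And>x. 0 \<le> g x" "\<And>x. x \<in> R \<Longrightarrow> c \<le> g x"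
  shows "c * measure lebesgue R \<le> (LINT x:Q|lebesgue. g x)"
proof -
  have "c * measure lebesgue R = (LINT x|lebesgue. c * indicator R x)"
    using R(1) by simp
  also have "\<dots> \<le> (LINT x|lebesgue. indicator Q x *\<^sub>R g x)"
  proof (rule integral_mono)
    show "integrable lebesgue (\<lambda>x. c * indicator R x)"
      using R(1) by (intro integrable_mult_right) (simp add: lmeasurable_iff_integrable)
    show "integrable lebesgue (\<lambda>x. indicator Q x *\<^sub>R g x)"
      using g(1) by (simp add: set_integrable_def)
    show "c * indicator R x \<le> indicator Q x *\<^sub>R g x" for x
      using g(2,3)[of x] R(2) by (auto simp: indicator_def)
  qed
  finally show ?thesis by (simp add: set_lebesgue_integral_def)
qed

text \<open>Inside a cube of stage \<open>m\<close> the tower equals \<open>a\<close> off stage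
  \<open>m + 1\<close> and is at least a + w^(m+1) on it, a part of relative measure 2^(-n). No
  constant is close to both values. The layer \<open>m + 1\<close> is present because
  \<open>m < K\<close>.\<close>

lemma tower_osc_ge:
  fixes j :: "int ^ 'n"
  assumes r: "1 \<le> r" and w: "0 < w" and m: "m < K"
    and sub: "dyadic_cube (- level_exp r m) j \<subseteq> sparse_set r m"
  shows "w ^ Suc m / 2 ^ Suc CARD('n) \<le> mean_osc (tower r w K) (dyadic_cube (- level_exp r m) j)"
proof -
  define Q where "Q = dyadic_cube (- level_exp r m) j"
  define Q' where "Q' = Q \<inter> sparse_set r (Suc m)"
  define a where "a = (\<Sum>i\<le>m. w ^ i)"
  define M where "M = mean_value (tower r w K) Q"
  let ?v = "w ^ Suc m"
  have Q: "Q \<in> lmeasurable" "0 < measure lebesgue Q"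
    unfolding Q_def by (simp_all add: lmeasurable_dyadic_cube measure_dyadic_cube_pos)
  have Q': "Q' \<in> lmeasurable" "Q' \<subseteq> Q"
    unfolding Q'_def by (rule fmeasurable.Int[OF Q(1) lmeasurable_sparse_set], rule Int_lower1)
  have QQ': "measure lebesgue Q = 2 ^ CARD('n) * measure lebesgue Q'"
    using measure_Int_sparse_set[OF r Q(1), of m 1] sub grid_set_dyadic_cube[of "- level_exp r m" j]
    by (simp add: Q_def Q'_def Int_absorb2 del: sparse_set.simps)
  have outer: "tower r w K x = a" if "x \<in> Q - Q'" for x
  proof -
    have "x \<notin> sparse_set r i" if "m < i" for i
      using that \<open>x \<in> Q - Q'\<close> sparse_set_antimono[of "Suc m" i r] by (auto simp: Q'_def)
    moreover have "x \<in> sparse_set r i" if "i \<le> m" for i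
      using that \<open>x \<in> Q - Q'\<close> sub sparse_set_antimono[of i m r] by (auto simp: Q_def)
    ultimately have "tower r w K x = (\<Sum>i\<in>{..m}. w ^ i * indicator (sparse_set r i) x)"
      unfolding tower_def using m by (intro sum.mono_neutral_right) (auto simp: not_le)
    also have "\<dots> = a"
      unfolding a_def using \<open>\<And>i. i \<le> m \<Longrightarrow> x \<in> sparse_set r i\<close> by (intro sum.cong) auto
    finally show ?thesis .
  qed
  have inner: "a + ?v \<le> tower r w K x" if "x \<in> Q'" for x
  proof -
    have "x \<in> sparse_set r i" if "i \<le> Suc m" for i
      using that \<open>x \<in> Q'\<close> sparse_set_antimono[of i "Suc m" r] unfolding Q'_def by blast
    then have "a + ?v = (\<Sum>i\<le>Suc m. w ^ i * indicator (sparse_set r i) x)"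
      by (simp add: a_def)
    also have "\<dots> \<le> tower r w K x"
      unfolding tower_def using m w by (intro sum_mono2) auto
    finally show ?thesis .
  qed
  \<comment> \<open>Since n \<ge> 1, the part outside \<open>Q'\<close> is at least as large as
    \<open>Q'\<close>, so both cases below yield the same bound.\<close>
  have "2 * measure lebesgue Q' \<le> measure lebesgue Q"
    unfolding QQ' using self_le_power[of "2::real" "CARD('n)"] by (intro mult_right_mono) auto
  moreover have "measure lebesgue (Q - Q') = measure lebesgue Q - measure lebesgue Q'"
    using Q Q' by (intro measurable_measure_Diff) (auto dest: fmeasurableD)
  ultimately have diff: "measure lebesgue Q' \<le> measure lebesgue (Q - Q')" by simp
  have int: "set_integrable lebesgue Q (\<lambda>x. \<bar>tower r w K x - M\<bar>)"
  proof (intro set_integrable_abs set_integral_diff(1))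
    show "set_integrable lebesgue Q (tower r w K)"
      by (rule set_integrable_tower[OF fmeasurableD[OF Q(1)]])
    show "set_integrable lebesgue Q (\<lambda>x. M)"
      unfolding set_integrable_def using Q(1) by (simp add: lmeasurable_iff_integrable)
  qed
  have "?v / 2 * measure lebesgue Q' \<le> (LINT x:Q|lebesgue. \<bar>tower r w K x - M\<bar>)"
    \<comment> \<open>\<open>M\<close> is at distance at least half the jump from the values on \<open>Q - Q'\<close> or from those on \<open>Q'\<close>.\<close>
  proof (cases "a + ?v / 2 \<le> M")
    case True
    have "?v / 2 * measure lebesgue Q' \<le> ?v / 2 * measure lebesgue (Q - Q')"
      using diff w by (intro mult_left_mono) auto
    also have "\<dots> \<le> (LINT x:Q|lebesgue. \<bar>tower r w K x - M\<bar>)"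
    proof (rule set_integral_ge_const[OF Q(1) fmeasurable.Diff[OF Q(1) Q'(1)] Diff_subset int])
      show "?v / 2 \<le> \<bar>tower r w K x - M\<bar>" if "x \<in> Q - Q'" for x
        using outer[OF that] True by linarith
    qed simp
    finally show ?thesis .
  next
    case False
    show ?thesis
    proof (rule set_integral_ge_const[OF Q(1) Q' int])
      show "?v / 2 \<le> \<bar>tower r w K x - M\<bar>" if "x \<in> Q'" for x
        using inner[OF that] False by linarith
    qed simp
  qed
  then have "?v / 2 * measure lebesgue Q' / measure lebesgue Q
      \<le> (LINT x:Q|lebesgue. \<bar>tower r w K x - M\<bar>) / measure lebesgue Q"
    using Q(2) by (intro divide_right_mono) auto
  also have "\<dots> = mean_osc (tower r w K) Q" by (simp add: mean_osc_def M_def)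
  finally have "?v / 2 * measure lebesgue Q' / measure lebesgue Q \<le> mean_osc (tower r w K) Q" .
  moreover have "0 < measure lebesgue Q'" using Q(2) unfolding QQ' by (simp add: zero_less_mult_iff)
  then have "?v / 2 * measure lebesgue Q' / measure lebesgue Q = ?v / 2 ^ Suc CARD('n)"
    unfolding QQ' by simp
  ultimately show ?thesis by (simp only: Q_def)
qed

definition level_cubes :: "real \<Rightarrow> nat \<Rightarrow> (real ^ 'n) set set" where
  "level_cubes r m = {Q. \<exists>j. Q = dyadic_cube (- level_exp r m) j \<and> Q \<subseteq> sparse_set r m}"

lemma dyadic_cube_nonempty: "dyadic_cube k j \<noteq> {}"
  using measure_dyadic_cube_pos[of k j] by auto

lemma Union_level_cubes:
  assumes r: "1 \<le> r"
  shows "\<Union> (level_cubes r m) = (sparse_set r m :: (real ^ 'n) set)"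
proof (intro equalityI subsetI)
  fix x :: "real ^ 'n"
  assume x: "x \<in> sparse_set r m"
  let ?Q = "dyadic_cube (- level_exp r m) (grid_index (- level_exp r m) x)"
  have "x \<in> ?Q" by (simp add: mem_dyadic_cube_iff)
  moreover have "?Q \<subseteq> sparse_set r m"
    using grid_set_cube_cases[OF grid_set_sparse[OF r]] x \<open>x \<in> ?Q\<close> by (metis IntI empty_iff)
  ultimately show "x \<in> \<Union> (level_cubes r m)" unfolding level_cubes_def by blast
qed (auto simp: level_cubes_def)

text \<open>These cubes lie in the unit cube, whose index is 0, so every coordinate of their index
  lies between 0 and \<open>2 ^ t - 1\<close>.\<close>

lemma finite_level_cubes:
  assumes r: "1 \<le> r"
  shows "finite (level_cubes r m :: (real ^ 'n) set set)"
proof -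
  define t where "t = nat (level_exp r m)"
  have t: "level_exp r m = int t" using level_exp_ge[OF r, of m] by (simp add: t_def)
  let ?J = "vec_lambda ` (UNIV \<rightarrow>\<^sub>E {0..<2 ^ t}) :: (int ^ 'n) set"
  have "level_cubes r m \<subseteq> dyadic_cube (- level_exp r m) ` ?J"
  proof
    fix Q :: "(real ^ 'n) set"
    assume "Q \<in> level_cubes r m"
    then obtain j where j: "Q = dyadic_cube (- level_exp r m) j" "Q \<subseteq> sparse_set r m"
      by (auto simp: level_cubes_def)
    obtain x where x: "x \<in> Q" using dyadic_cube_nonempty j(1) by blast
    then have idx: "grid_index (- level_exp r m) x = j"
      using j(1) by (simp add: mem_dyadic_cube_iff)
    have "x \<in> dyadic_cube 0 0" using x j(2) sparse_set_antimono[of 0 m r] by auto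
    then have "grid_index 0 x = 0" by (simp add: mem_dyadic_cube_iff)
    with idx have div0: "j $ c div 2 ^ t = 0" for c
      using grid_index_coarsen[of "- level_exp r m" t x c] by (simp add: t)
    have "j $ c \<in> {0..<2 ^ t}" for c
    proof -
      have "(0::int) < 2 ^ t" by simp
      then show ?thesis using div0[of c] unfolding zdiv_eq_0_iff atLeastLessThan_iff by linarith
    qed
    then have "j \<in> ?J" by (intro image_eqI[of _ _ "vec_nth j"]) auto
    then show "Q \<in> dyadic_cube (- level_exp r m) ` ?J" using j(1) by blast
  qed
  moreover have "finite ?J" by (intro finite_imageI finite_PiE) auto
  ultimately show ?thesis by (meson finite_imageI finite_subset)
qed

lemma sum_measure_level_cubes:
  assumes r: "1 \<le> r"
  shows "(\<Sum>Q\<in>level_cubes r m. measure lebesgue (Q :: (real ^ 'n) set)) = measure lebesgue (sparse_set r m :: (real ^ 'n) set)"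
proof -
  have lm: "Q \<in> lmeasurable" if "Q \<in> level_cubes r m" for Q :: "(real ^ 'n) set"
    using that lmeasurable_dyadic_cube unfolding level_cubes_def by blast
  have "measure lebesgue (\<Union>Q\<in>level_cubes r m. Q :: (real ^ 'n) set) = (\<Sum>Q\<in>level_cubes r m. measure lebesgue (Q :: (real ^ 'n) set))"
  proof (rule measure_finite_Union)
    show "disjoint_family_on (\<lambda>Q. Q) (level_cubes r m :: (real ^ 'n) set set)"
      by (auto simp: disjoint_family_on_def level_cubes_def mem_dyadic_cube_iff)
    show "emeasure lebesgue Q \<noteq> \<infinity>" if "Q \<in> level_cubes r m" for Q :: "(real ^ 'n) set"
      unfolding infinity_ennreal_def by (rule fmeasurableD2[OF lm[OF that]])
  qed (use fmeasurableD[OF lm] finite_level_cubes[OF r] in auto)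
  then show ?thesis by (simp add: Union_level_cubes[OF r])
qed

text \<open>The factor \<open>side_length Q powr (\<gamma> / p)\<close> cancels the growth w^m of
  the oscillations, so one threshold \<open>l\<close> captures the cubes of all levels m < K. Each
  level then contributes at least \<open>2 powr (- \<gamma>)\<close>.\<close>

lemma weak_seq_norm_tower_ge:
  fixes p \<gamma> :: real
  assumes p: "1 < p" and \<gamma>: "0 < \<gamma>" "\<gamma> \<le> real CARD('n)"
  defines "r \<equiv> real CARD('n) / \<gamma>" and "w \<equiv> 2 powr (real CARD('n) / p)"
  defines "l \<equiv> w / 2 ^ (CARD('n) + 2)"
  shows "ennreal ((l powr p * 2 powr (- \<gamma>) * real K) powr (1 / p))
      \<le> weak_seq_norm p \<gamma> (osc_seq p \<gamma> (tower r w K :: real ^ 'n \<Rightarrow> real))"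
proof -
  let ?f = "tower r w K :: real ^ 'n \<Rightarrow> real"
  let ?b = "osc_seq p \<gamma> ?f"
  let ?g = "\<lambda>Q :: (real ^ 'n) set. side_length Q powr (- \<gamma>) * measure lebesgue Q"
  let ?N = "real CARD('n)"
  have r: "1 \<le> r" using \<gamma> by (simp add: r_def)
  have w: "0 < w" by (simp add: w_def)
  have l: "0 < l" using w by (simp add: l_def)
  have wm: "w ^ m = 2 powr (?N * real m / p)" for m
    by (simp add: w_def powr_power mult.commute)
  \<comment> \<open>The upper bound keeps the sides large enough for \<open>big\<close>; the lower
    bound keeps the weights large enough for \<open>mass\<close>, with the loss \<gamma> due to
    rounding.\<close>
  have tau: "real_of_int (level_exp r m) * \<gamma> \<le> ?N * real m" "?N * real m - \<gamma> \<le> real_of_int (level_exp r m) * \<gamma>" for m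
  proof -
    have "real_of_int (level_exp r m) \<le> ?N * real m / \<gamma>" "?N * real m / \<gamma> - 1 \<le> real_of_int (level_exp r m)"
      unfolding level_exp_def r_def by (simp_all add: mult.commute)
    then show "real_of_int (level_exp r m) * \<gamma> \<le> ?N * real m" "?N * real m - \<gamma> \<le> real_of_int (level_exp r m) * \<gamma>"
      using \<gamma> by (simp_all add: field_simps)
  qed
  have side: "side_length Q = 2 powr (- real_of_int (level_exp r m))" if "Q \<in> level_cubes r m" for Q :: "(real ^ 'n) set" and m
    using that by (auto simp: level_cubes_def side_length_dyadic_cube powr_real_of_int' simp flip: of_int_minus)
  have big: "l < \<bar>?b Q\<bar>" if Q: "Q \<in> level_cubes r m" and m: "m < K" for Q m
  proof -
    have "w ^ Suc m / 2 ^ Suc CARD('n) \<le> mean_osc ?f Q"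
      using Q tower_osc_ge[OF r w m] by (auto simp: level_cubes_def)
    moreover have "2 powr (- (?N * real m / p)) \<le> side_length Q powr (\<gamma> / p)"
      using tau(1)[of m] p by (simp add: side[OF Q] powr_powr divide_right_mono)
    ultimately have "2 powr (- (?N * real m / p)) * (w ^ Suc m / 2 ^ Suc CARD('n)) \<le> ?b Q"
      unfolding osc_seq_def using w by (intro mult_mono) auto
    \<comment> \<open>The extra factor 2 in the denominator of \<open>l\<close> makes the inequality
      strict.\<close>
    moreover have "2 powr (- (?N * real m / p)) * (w ^ Suc m / 2 ^ Suc CARD('n)) = 2 * l"
      by (simp add: wm l_def powr_minus)
    ultimately show ?thesis using l by linarith
  qed
  have mass: "2 powr (- \<gamma>) \<le> (\<Sum>Q\<in>level_cubes r m. ?g Q)" for m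
  proof -
    have "2 powr (- \<gamma>) = 2 powr (?N * real m - \<gamma>) * measure lebesgue (sparse_set r m :: (real ^ 'n) set)"
      by (simp add: measure_sparse_set[OF r] powr_diff powr_minus powr_realpow[symmetric] field_simps)
    also have "\<dots> = (\<Sum>Q\<in>level_cubes r m. 2 powr (?N * real m - \<gamma>) * measure lebesgue (Q :: (real ^ 'n) set))"
      by (simp only: sum_distrib_left sum_measure_level_cubes[OF r, symmetric])
    also have "\<dots> \<le> (\<Sum>Q\<in>level_cubes r m. ?g Q)"
      using tau(2)[of m] by (intro sum_mono mult_right_mono) (auto simp: side powr_powr)
    finally show ?thesis .
  qed
  \<comment> \<open>Cubes of different levels may be nested. The weak sequence norm counts them all,
    whereas the collections in \<open>JN_norm\<close> must be disjoint.\<close>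
  define U where "U = (\<Union>m<K. level_cubes r m :: (real ^ 'n) set set)"
  have U: "finite U" "U \<subseteq> {Q \<in> dyadic_cubes. l < \<bar>?b Q\<bar>}"
    using finite_level_cubes[OF r] big by (auto simp: U_def dyadic_cubes_def level_cubes_def)
  have "real K * 2 powr (- \<gamma>) = (\<Sum>m<K. 2 powr (- \<gamma>))" by simp
  also have "\<dots> \<le> (\<Sum>m<K. \<Sum>Q\<in>level_cubes r m. ?g Q)" by (intro sum_mono mass)
  also have "\<dots> = (\<Sum>Q\<in>U. ?g Q)"
    unfolding U_def
  proof (rule sum.UNION_disjoint[symmetric])
    show "\<forall>m\<in>{..<K}. \<forall>m'\<in>{..<K}. m \<noteq> m' \<longrightarrow> level_cubes r m \<inter> level_cubes r m' = ({} :: (real ^ 'n) set set)"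
    \<comment> \<open>The side length determines the level because \<open>level_exp r\<close> is
      strictly increasing.\<close>
    proof (intro ballI impI equals0I)
      fix m m' and Q :: "(real ^ 'n) set"
      assume "m \<noteq> m'" "Q \<in> level_cubes r m \<inter> level_cubes r m'"
      then have "(2::real) powr - real_of_int (level_exp r m) = 2 powr - real_of_int (level_exp r m')"
        using side[of Q m] side[of Q m'] by (metis IntD1 IntD2)
      then have "level_exp r m = level_exp r m'" by (simp add: powr_inj)
      then show False using \<open>m \<noteq> m'\<close> level_exp_strict_mono[OF r] by (simp add: strict_mono_eq)
    qed
  qed (use finite_level_cubes[OF r] in auto)
  finally have sumU: "real K * 2 powr (- \<gamma>) \<le> (\<Sum>Q\<in>U. ?g Q)" .
  have lmU: "Q \<in> lmeasurable" if "Q \<in> U" for Q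
    using that lmeasurable_dyadic_cube unfolding U_def level_cubes_def by blast
  have "ennreal (l powr p * 2 powr (- \<gamma>) * real K) \<le> ennreal (l powr p * (\<Sum>Q\<in>U. ?g Q))"
    using mult_left_mono[OF sumU, of "l powr p"] by (intro ennreal_leI) (simp add: mult_ac)
  also have "\<dots> = ennreal (l powr p) * (\<Sum>Q\<in>U. ennreal (?g Q))"
    by (subst sum_ennreal) (auto simp: ennreal_mult sum_nonneg)
  also have "(\<Sum>Q\<in>U. ennreal (?g Q)) = (\<Sum>Q\<in>U. ennreal (side_length Q powr (- \<gamma>)) * emeasure lebesgue Q)"
    by (intro sum.cong refl, subst emeasure_eq_measure2[OF lmU], simp, subst ennreal_mult) auto
  also have "\<dots> \<le> (\<Sum>\<^sub>\<infinity>Q\<in>{Q \<in> dyadic_cubes. \<bar>?b Q\<bar> > l}. ennreal (side_length Q powr (- \<gamma>)) * emeasure lebesgue Q)"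
    using U by (subst nonneg_infsum_complete, simp) (intro SUP_upper, simp)
  finally have "ennreal (l powr p * 2 powr (- \<gamma>) * real K)
      \<le> ennreal (l powr p) * (\<Sum>\<^sub>\<infinity>Q\<in>{Q \<in> dyadic_cubes. \<bar>?b Q\<bar> > l}. ennreal (side_length Q powr (- \<gamma>)) * emeasure lebesgue Q)"
    by (simp add: mult_left_mono)
  also have "\<dots> \<le> (SUP l\<in>{0<..}. ennreal (l powr p) *
      (\<Sum>\<^sub>\<infinity>Q\<in>{Q \<in> dyadic_cubes. \<bar>?b Q\<bar> > l}. ennreal (side_length Q powr (- \<gamma>)) * emeasure lebesgue Q))"
    using l by (intro SUP_upper) simp
  finally have "ennreal_powr (ennreal (l powr p * 2 powr (- \<gamma>) * real K)) (1 / p) \<le> weak_seq_norm p \<gamma> ?b"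
    unfolding weak_seq_norm_def using p by (intro ennreal_powr_mono) auto
  then show ?thesis by (simp add: ennreal_powr_ennreal)
qed

section \<open>Failure of both inequalities\<close>

theorem claim7p3:
  fixes p \<gamma> :: real
  assumes "1 < p" and "0 < \<gamma>" and "\<gamma> \<le> real CARD('n::finite)"
  shows "(\<nexists>C::real. \<forall>f :: real ^ 'n \<Rightarrow> real. locally_integrable f \<longrightarrow>
            weak_seq_norm p \<gamma> (osc_seq p \<gamma> f) \<le> ennreal C * JN_norm p f)
       \<and> (\<nexists>C::real. \<forall>f :: real ^ 'n \<Rightarrow> real. locally_integrable f \<longrightarrow>
            weak_seq_norm p \<gamma> (osc_seq p \<gamma> f) \<le> ennreal C * weak_Lp_norm p f)"
proof -
  define r w where "r = real CARD('n) / \<gamma>" and "w = 2 powr (real CARD('n) / p)"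
  have r: "1 \<le> r" using assms by (simp add: r_def)
  have w: "0 < w" "w powr p = 2 ^ CARD('n)"
    using assms by (simp_all add: w_def powr_powr powr_realpow)
  define c where "c = (w / 2 ^ (CARD('n) + 2)) powr p * 2 powr (- \<gamma>)"
  have c: "0 < c" using w by (simp add: c_def)
  \<comment> \<open>Only a bound for \<Phi> on the towers, uniform in \<open>K\<close>, is needed,
    so one argument covers both norms.\<close>
  have no_bound: "\<nexists>C::real. \<forall>f :: real ^ 'n \<Rightarrow> real. locally_integrable f \<longrightarrow>
            weak_seq_norm p \<gamma> (osc_seq p \<gamma> f) \<le> ennreal C * \<Phi> f"
    if \<Phi>: "\<And>K. \<Phi> (tower r w K) \<le> ennreal B" for \<Phi> :: "(real ^ 'n \<Rightarrow> real) \<Rightarrow> ennreal" and B :: real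
  proof
    assume "\<exists>C::real. \<forall>f :: real ^ 'n \<Rightarrow> real. locally_integrable f \<longrightarrow>
            weak_seq_norm p \<gamma> (osc_seq p \<gamma> f) \<le> ennreal C * \<Phi> f"
    then obtain C :: real where C: "weak_seq_norm p \<gamma> (osc_seq p \<gamma> f) \<le> ennreal C * \<Phi> f"
      if "locally_integrable f" for f :: "real ^ 'n \<Rightarrow> real"
      by blast
    \<comment> \<open>The maxima match the convention that \<open>ennreal\<close> sends negative
      reals to 0.\<close>
    define D where "D = max 0 C * max 0 B"
    have D: "(c * real K) powr (1 / p) \<le> D" for K
    proof -
      have "ennreal ((c * real K) powr (1 / p)) \<le> weak_seq_norm p \<gamma> (osc_seq p \<gamma> (tower r w K :: real ^ 'n \<Rightarrow> real))"
        using weak_seq_norm_tower_ge[where 'n = 'n, OF assms] by (simp only: c_def r_def w_def)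
      also have "\<dots> \<le> ennreal C * ennreal B"
        using C[OF locally_integrable_tower, of r w K] \<Phi>[of K] by (meson mult_left_mono order_trans zero_le)
      also have "\<dots> = ennreal D" by (simp add: D_def ennreal_mult ennreal_max_0)
      finally show ?thesis by (simp add: D_def)
    qed
    obtain K where K: "D powr p / c < real K" using reals_Archimedean2 by blast
    have "c * real K = ((c * real K) powr (1 / p)) powr p"
      using c assms by (simp add: powr_powr)
    also have "\<dots> \<le> D powr p" using D assms by (intro powr_mono2) auto
    finally show False using K c by (simp add: field_simps)
  qed
  show ?thesis
    using no_bound[of "JN_norm p", OF JN_norm_tower_le[OF r assms(1) w]]
      no_bound[of "weak_Lp_norm p", OF weak_Lp_norm_tower_le[OF r assms(1) w]] by (rule conjI)
qed

end
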